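(* For each integer $n\ge 2$ let $\pi=\pi_n$ be chosen uniformly at random from the symmetric group $S_n$, and let $T(\pi) := D(\pi)+D(\pi^{-1})$, where $D$ denotes the number of descents. Then for every $n\ge 2$, $$\mathbb{E}(T(\pi)) = n-1, \qquad \mathrm{Var}(T(\pi)) = \frac{n+7}{6}-\frac{1}{n},$$ and, as $n\to\infty$, the normalized random variable $$\frac{T(\pi)-\mathbb{E}(T(\pi))}{\sqrt{\mathrm{Var}(T(\pi))}}$$ converges in distribution to the standard normal distribution $N(0,1)$.
   Context: $S_n$ is the group of all $n!$ permutations of $\{1,\ldots,n\}$, and $\pi^{-1}$ is the inverse permutation of $\pi$. For $\pi\in S_n$, the number of descents of $\pi$ is $D(\pi) := |\{i: 1\le i\le n-1,\ \pi(i+1)<\pi(i)\}|$. *)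

theory Defs
  imports "HOL-Probability.Probability" "HOL-Combinatorics.Permutations"
begin

text \<open>
  An element of \<open>S\<^sub>n\<close> is a function on the naturals that permutes \<open>{1..n}\<close> and is the identity
  elsewhere, so its group inverse is the functional inverse \<^term>\<open>inv\<close>.
\<close>

definition sym_group :: "nat \<Rightarrow> (nat \<Rightarrow> nat) set" where
  "sym_group n = {p. p permutes {1..n}}"

definition uniform_perm :: "nat \<Rightarrow> (nat \<Rightarrow> nat) pmf" where
  "uniform_perm n = pmf_of_set (sym_group n)"

text \<open>The size \<open>n\<close> has to be passed explicitly, since it cannot be recovered from the function.\<close>

definition descents :: "nat \<Rightarrow> (nat \<Rightarrow> nat) \<Rightarrow> nat" where
  "descents n p = card {i. 1 \<le> i \<and> i \<le> n - 1 \<and> p (i + 1) < p i}"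

definition two_sided_descents :: "nat \<Rightarrow> (nat \<Rightarrow> nat) \<Rightarrow> real" where
  "two_sided_descents n p = real (descents n p + descents n (inv p))"

end

theory Submission
  imports Defs "HOL-Real_Asymp.Real_Asymp"
begin

text \<open>
  The proof is Stein's method of exchangeable pairs, with characteristic functions as test functions.
  Let \<open>S\<close> be the sum, over \<open>p\<close> and its inverse, of the number of descents minus the number of ascents;
  then \<open>S = 2 (T - (n - 1))\<close>. Mean and variance of \<open>S\<close> follow from symmetries: exchanging two
  adjacent entries flips the sign of one step and leaves almost all other signs alone, of
  \<open>p\<close> and of the inverse (\<open>sum_step_sign_inverse\<close>).

  Let \<open>p'\<close> be \<open>p\<close> composed with the transposition of two independent uniform points. The law of
  \<open>(p, p')\<close> is symmetric, the inverse of \<open>p'\<close> arises from the inverse of \<open>p\<close> in the same way, and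
  \<open>S\<close> has an almost linear drift: the expectation of \<open>S p' - S p\<close> given \<open>p\<close> is \<open>- (4 / n) S p\<close> plus a
  remainder of order \<open>1 / n\<close> that only depends on the end points (\<open>two_sided_balance_drift\<close>).

  Hence, up to small errors, the mean of \<open>S * exp (\<i> \<theta> S)\<close> is \<open>\<i> \<theta>\<close> times the mean of
  \<open>G * exp (\<i> \<theta> S)\<close>, where \<open>G\<close> is the conditional second moment of the increment divided by twice the
  rate \<open>4 / n\<close> (\<open>stein_characteristic_bound\<close>). Transpositions act locally, so one transposition
  changes \<open>G\<close> by a bounded amount (\<open>squared_increments_transposition_le\<close>, in which \<open>G\<close> is scaled by
  \<open>8 n\<close>), and the variance of \<open>G\<close> is at most of order \<open>n\<close> (\<open>permutations_variance_bound\<close>); the mean of \<open>G\<close>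
  is the variance of \<open>S\<close> up to an error of order \<open>sqrt n\<close>, and that variance is itself of
  order \<open>n\<close>. The characteristic function \<open>\<phi>\<close> of the normalized statistic therefore satisfies
  \<open>\<phi>' t = - t \<phi> t + O (1 / sqrt n)\<close>, which forces convergence to \<open>exp (- t\<^sup>2 / 2)\<close>, and Levy's
  continuity theorem finishes the proof.
\<close>

text \<open>The plain name \<open>transpose\<close> denotes the matrix transpose here.\<close>

abbreviation transposition :: "'a \<Rightarrow> 'a \<Rightarrow> 'a \<Rightarrow> 'a" where
  "transposition \<equiv> Transposition.transpose"

section \<open>Exchangeable pairs and characteristic functions\<close>

text \<open>
  The exchangeable pair identity. A uniform point \<open>a\<close> and its image under a random involution form an
  exchangeable pair, so antisymmetric functions of the pair sum to zero; applied to
  \<open>(f a' - f a) (g a' + g a)\<close> this turns a linear drift of \<open>f\<close> into a formula for the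
  correlation of \<open>f\<close> with an arbitrary \<open>g\<close>.
\<close>

lemma involution_green_identity:
  fixes f r :: "'a \<Rightarrow> real" and g :: "'a \<Rightarrow> 'b :: real_normed_field"
  assumes "\<And>j a. j \<in> J \<Longrightarrow> a \<in> A \<Longrightarrow> \<sigma> j a \<in> A"
    and "\<And>j a. j \<in> J \<Longrightarrow> a \<in> A \<Longrightarrow> \<sigma> j (\<sigma> j a) = a"
    and drift: "\<And>a. a \<in> A \<Longrightarrow> (\<Sum>j\<in>J. f (\<sigma> j a) - f a) = - \<kappa> * f a + r a"
  shows "2 * of_real \<kappa> * (\<Sum>a\<in>A. of_real (f a) * g a) =
    (\<Sum>a\<in>A. \<Sum>j\<in>J. of_real (f (\<sigma> j a) - f a) * (g (\<sigma> j a) - g a))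
    + 2 * (\<Sum>a\<in>A. of_real (r a) * g a)"
proof -
  define \<Delta> where "\<Delta> j a = (of_real (f (\<sigma> j a) - f a) :: 'b)" for j a
  have flip: "(\<Sum>a\<in>A. \<Delta> j a * g (\<sigma> j a)) = - (\<Sum>a\<in>A. \<Delta> j a * g a)" if "j \<in> J" for j
  proof -
    have "(\<Sum>a\<in>A. \<Delta> j a * g (\<sigma> j a)) = (\<Sum>a\<in>A. of_real (f a - f (\<sigma> j a)) * g a)"
      unfolding \<Delta>_def
      by (rule sum.reindex_bij_witness[of _ "\<sigma> j" "\<sigma> j"]) (use assms(1,2) that in auto)
    also have "\<dots> = (\<Sum>a\<in>A. - (\<Delta> j a * g a))"
      unfolding \<Delta>_def
      by (intro sum.cong) (auto simp: algebra_simps)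
    finally show ?thesis by (simp only: sum_negf)
  qed
  have "(\<Sum>a\<in>A. \<Sum>j\<in>J. \<Delta> j a * (g (\<sigma> j a) - g a)) =
    (\<Sum>j\<in>J. (\<Sum>a\<in>A. \<Delta> j a * g (\<sigma> j a)) - (\<Sum>a\<in>A. \<Delta> j a * g a))"
    by (subst sum.swap) (simp add: right_diff_distrib sum_subtractf)
  also have "\<dots> = (\<Sum>j\<in>J. - 2 * (\<Sum>a\<in>A. \<Delta> j a * g a))"
    by (intro sum.cong refl) (simp only: flip, simp)
  also have "\<dots> = - 2 * (\<Sum>a\<in>A. of_real (\<Sum>j\<in>J. f (\<sigma> j a) - f a) * g a)"
    unfolding sum_distrib_left[symmetric]
    by (subst sum.swap) (simp add: sum_distrib_right \<Delta>_def)
  also have "\<dots> = - 2 * (\<Sum>a\<in>A. of_real (- \<kappa> * f a + r a) * g a)"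
    by (simp only: drift cong: sum.cong)
  also have "\<dots> = 2 * of_real \<kappa> * (\<Sum>a\<in>A. of_real (f a) * g a) - 2 * (\<Sum>a\<in>A. of_real (r a) * g a)"
    by (simp add: algebra_simps sum.distrib sum_subtractf sum_distrib_left sum_negf)
  finally show ?thesis by (simp add: \<Delta>_def)
qed

lemma sum_abs_le_sqrt:
  fixes h :: "'a \<Rightarrow> real" and V :: real
  assumes "(\<Sum>a\<in>A. (h a)\<^sup>2) \<le> card A * V" "V \<ge> 0"
  shows "(\<Sum>a\<in>A. \<bar>h a\<bar>) \<le> card A * sqrt V"
proof -
  have "(\<Sum>a\<in>A. \<bar>h a\<bar> * 1)\<^sup>2 \<le> (\<Sum>a\<in>A. \<bar>h a\<bar>\<^sup>2) * (\<Sum>a\<in>A. 1\<^sup>2)"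
    by (rule Cauchy_Schwarz_ineq_sum)
  also have "\<dots> \<le> (card A * V) * card A"
    using assms by (simp add: mult_right_mono)
  also have "\<dots> = (card A * sqrt V)\<^sup>2"
    using assms by (simp add: power_mult_distrib power2_eq_square)
  finally have "(\<Sum>a\<in>A. \<bar>h a\<bar>)\<^sup>2 \<le> (card A * sqrt V)\<^sup>2" by (simp only: mult_1_right)
  then show ?thesis by (rule power2_le_imp_le) (use assms(2) in simp)
qed

text \<open>
  The Stein identity tested on complex exponentials. Here \<open>v\<close> is the second moment of \<open>f\<close>, \<open>G\<close> is the
  sum of squared increments and \<open>V\<close> bounds its variance. Expanding the exponential to first order
  in the increment leaves \<open>\<i> \<theta> G\<close>; the same identity tested on \<open>f\<close> itself shows that the
  mean of \<open>G\<close> is close to \<open>2 \<kappa> v\<close>.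
\<close>

lemma stein_characteristic_bound:
  fixes f r :: "'a \<Rightarrow> real" and \<theta> \<kappa> \<rho> K v V :: real
    and A :: "'a set" and J :: "'j set" and \<sigma> :: "'j \<Rightarrow> 'a \<Rightarrow> 'a"
  defines "G \<equiv> \<lambda>a. \<Sum>j\<in>J. (f (\<sigma> j a) - f a)\<^sup>2"
  assumes A: "finite A" "A \<noteq> {}"
    and inv: "\<And>j a. j \<in> J \<Longrightarrow> a \<in> A \<Longrightarrow> \<sigma> j a \<in> A"
    "\<And>j a. j \<in> J \<Longrightarrow> a \<in> A \<Longrightarrow> \<sigma> j (\<sigma> j a) = a"
    and drift: "\<And>a. a \<in> A \<Longrightarrow> (\<Sum>j\<in>J. f (\<sigma> j a) - f a) = - \<kappa> * f a + r a"
    and K: "\<And>j a. j \<in> J \<Longrightarrow> a \<in> A \<Longrightarrow> \<bar>f (\<sigma> j a) - f a\<bar> \<le> K"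
    and \<rho>: "\<And>a. a \<in> A \<Longrightarrow> \<bar>r a\<bar> \<le> \<rho>"
    and v: "(\<Sum>a\<in>A. (f a)\<^sup>2) = card A * v"
    and V: "(\<Sum>a\<in>A. (G a - (\<Sum>a\<in>A. G a) / card A)\<^sup>2) \<le> card A * V"
  shows "cmod (2 * \<kappa> * (\<Sum>a\<in>A. f a * iexp (\<theta> * f a)) - 2 * \<kappa> * v * (\<i> * \<theta>) * (\<Sum>a\<in>A. iexp (\<theta> * f a)))
    \<le> card A * (\<bar>\<theta>\<bar> * (sqrt V + 2 * \<rho> * sqrt v) + \<theta>\<^sup>2 / 2 * card J * K ^ 3 + 2 * \<rho>)"
proof -
  define N where "N = real (card A)"
  define e where "e a = iexp (\<theta> * f a)" for a
  define \<Delta> where "\<Delta> j a = f (\<sigma> j a) - f a" for j a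
  define m where "m = (\<Sum>a\<in>A. G a) / card A"
  have N: "N > 0" using A by (simp add: N_def card_gt_0_iff)
  have norm_e: "cmod (e a) = 1" for a by (simp add: e_def)
  have \<rho>0: "\<rho> \<ge> 0" using \<rho> A by (meson abs_ge_zero all_not_in_conv order_trans)
  have "N * v \<ge> 0" "N * V \<ge> 0"
    using v V sum_nonneg[of A "\<lambda>a. (f a)\<^sup>2"] sum_nonneg[of A "\<lambda>a. (G a - m)\<^sup>2"]
    by (auto simp: N_def m_def)
  then have v0: "v \<ge> 0" and V0: "V \<ge> 0" using N by (simp_all add: zero_le_mult_iff)

  have rf: "\<bar>\<Sum>a\<in>A. r a * f a\<bar> \<le> N * (\<rho> * sqrt v)"
  proof -
    have "\<bar>\<Sum>a\<in>A. r a * f a\<bar> \<le> (\<Sum>a\<in>A. \<rho> * \<bar>f a\<bar>)"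
      using \<rho> by (intro order_trans[OF sum_abs] sum_mono) (simp add: abs_mult mult_right_mono)
    also have "\<dots> \<le> \<rho> * (N * sqrt v)"
      unfolding sum_distrib_left[symmetric] N_def
      using sum_abs_le_sqrt[of f A v] v v0 \<rho>0 by (intro mult_left_mono) auto
    finally show ?thesis by (simp add: algebra_simps)
  qed
  have mean_G: "N * (2 * \<kappa> * v - m) = 2 * (\<Sum>a\<in>A. r a * f a)"
    using involution_green_identity[OF inv drift, of f] v N
    by (simp add: G_def m_def N_def power2_eq_square algebra_simps)
  have "N * \<bar>m - 2 * \<kappa> * v\<bar> = \<bar>N * (2 * \<kappa> * v - m)\<bar>"
    using N by (simp add: abs_mult abs_minus_commute)
  then have "N * \<bar>m - 2 * \<kappa> * v\<bar> \<le> N * (2 * \<rho> * sqrt v)"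
    using rf unfolding mean_G abs_mult by simp
  moreover have "(\<Sum>a\<in>A. \<bar>G a - m\<bar>) \<le> N * sqrt V"
    unfolding N_def using sum_abs_le_sqrt[of "\<lambda>a. G a - m" A V] V V0 by (simp add: m_def)
  moreover have "(\<Sum>a\<in>A. \<bar>G a - 2 * \<kappa> * v\<bar>) \<le> (\<Sum>a\<in>A. \<bar>G a - m\<bar> + \<bar>m - 2 * \<kappa> * v\<bar>)"
    by (intro sum_mono) linarith
  ultimately have conc: "(\<Sum>a\<in>A. \<bar>G a - 2 * \<kappa> * v\<bar>) \<le> N * (sqrt V + 2 * \<rho> * sqrt v)"
    by (simp add: sum.distrib N_def algebra_simps)

  have taylor: "cmod (\<Delta> j a * (e (\<sigma> j a) - e a) - \<i> * \<theta> * (\<Delta> j a)\<^sup>2 * e a) \<le> \<theta>\<^sup>2 / 2 * K ^ 3"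
    if "j \<in> J" "a \<in> A" for j a
  proof -
    have "e (\<sigma> j a) = e a * iexp (\<theta> * \<Delta> j a)"
      by (simp add: e_def \<Delta>_def algebra_simps flip: exp_add)
    then have "\<Delta> j a * (e (\<sigma> j a) - e a) - \<i> * \<theta> * (\<Delta> j a)\<^sup>2 * e a
      = \<Delta> j a * e a * (iexp (\<theta> * \<Delta> j a) - (1 + \<i> * (\<theta> * \<Delta> j a)))"
      by (simp add: algebra_simps power2_eq_square)
    then have "cmod (\<Delta> j a * (e (\<sigma> j a) - e a) - \<i> * \<theta> * (\<Delta> j a)\<^sup>2 * e a)
      = \<bar>\<Delta> j a\<bar> * cmod (iexp (\<theta> * \<Delta> j a) - (1 + \<i> * (\<theta> * \<Delta> j a)))"
      by (simp add: norm_mult norm_e)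
    also have "\<dots> \<le> \<bar>\<Delta> j a\<bar> * (\<bar>\<theta> * \<Delta> j a\<bar>\<^sup>2 / 2)"
      using iexp_approx1[of "\<theta> * \<Delta> j a" 1] by (intro mult_left_mono) (simp_all add: numeral_2_eq_2)
    also have "\<dots> = \<theta>\<^sup>2 / 2 * \<bar>\<Delta> j a\<bar> ^ 3"
      by (simp add: power_mult_distrib power3_eq_cube power2_eq_square)
    also have "\<dots> \<le> \<theta>\<^sup>2 / 2 * K ^ 3"
      using K[OF that] by (intro mult_left_mono power_mono) (auto simp: \<Delta>_def)
    finally show ?thesis .
  qed

  have green: "2 * \<kappa> * (\<Sum>a\<in>A. f a * e a)
      = (\<Sum>a\<in>A. \<Sum>j\<in>J. \<Delta> j a * (e (\<sigma> j a) - e a)) + 2 * (\<Sum>a\<in>A. r a * e a)"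
    unfolding \<Delta>_def using involution_green_identity[OF inv drift, of e] by simp
  have collect: "s + z - c * t * q = x + t * y + z"
    if "s = x + t * u" "y = u - c * q" for s x t u y c q z :: complex
    unfolding that by (simp add: algebra_simps)
  have "(\<Sum>j\<in>J. \<Delta> j a * (e (\<sigma> j a) - e a))
    = (\<Sum>j\<in>J. \<Delta> j a * (e (\<sigma> j a) - e a) - \<i> * \<theta> * (\<Delta> j a)\<^sup>2 * e a) + \<i> * \<theta> * (G a * e a)" for a
  proof -
    have "\<i> * \<theta> * (G a * e a) = (\<Sum>j\<in>J. \<i> * \<theta> * (\<Delta> j a)\<^sup>2 * e a)"
      by (simp add: G_def \<Delta>_def sum_distrib_left sum_distrib_right mult.assoc)
    then show ?thesis by (simp add: sum_subtractf)
  qed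
  then have "(\<Sum>a\<in>A. \<Sum>j\<in>J. \<Delta> j a * (e (\<sigma> j a) - e a))
    = (\<Sum>a\<in>A. \<Sum>j\<in>J. \<Delta> j a * (e (\<sigma> j a) - e a) - \<i> * \<theta> * (\<Delta> j a)\<^sup>2 * e a)
      + \<i> * \<theta> * (\<Sum>a\<in>A. G a * e a)"
    by (simp only: sum.distrib sum_distrib_left)
  moreover have "(\<Sum>a\<in>A. (G a - 2 * \<kappa> * v) * e a) = (\<Sum>a\<in>A. G a * e a) - 2 * \<kappa> * v * (\<Sum>a\<in>A. e a)"
    by (simp add: left_diff_distrib sum_subtractf sum_distrib_left)
  ultimately have "2 * \<kappa> * (\<Sum>a\<in>A. f a * e a) - 2 * \<kappa> * v * (\<i> * \<theta>) * (\<Sum>a\<in>A. e a)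
    = (\<Sum>a\<in>A. \<Sum>j\<in>J. \<Delta> j a * (e (\<sigma> j a) - e a) - \<i> * \<theta> * (\<Delta> j a)\<^sup>2 * e a)
      + \<i> * \<theta> * (\<Sum>a\<in>A. (G a - 2 * \<kappa> * v) * e a) + 2 * (\<Sum>a\<in>A. r a * e a)"
    (is "?L = ?X + ?Y + ?Z") unfolding green by (rule collect)
  then have "cmod ?L \<le> cmod ?X + cmod ?Y + cmod ?Z"
    by (simp only:) (intro order_trans[OF norm_triangle_ineq] add_right_mono norm_triangle_ineq)
  moreover have "cmod ?X \<le> N * (card J * (\<theta>\<^sup>2 / 2 * K ^ 3))"
    unfolding N_def using taylor
    by (intro order_trans[OF norm_sum] sum_bounded_above)
  moreover have "cmod ?Y \<le> \<bar>\<theta>\<bar> * (N * (sqrt V + 2 * \<rho> * sqrt v))"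
  proof -
    have "cmod (\<Sum>a\<in>A. (G a - 2 * \<kappa> * v) * e a) \<le> (\<Sum>a\<in>A. \<bar>G a - 2 * \<kappa> * v\<bar>)"
      by (rule order_trans[OF norm_sum])
        (simp only: norm_mult norm_of_real norm_e mult_1_right order_refl)
    then show ?thesis
      using conc by (simp add: norm_mult mult_left_mono)
  qed
  moreover have "cmod ?Z \<le> 2 * (N * \<rho>)"
  proof -
    have "cmod (\<Sum>a\<in>A. r a * e a) \<le> N * \<rho>"
      unfolding N_def using \<rho>
      by (intro order_trans[OF norm_sum] sum_bounded_above) (simp add: norm_mult norm_e)
    then show ?thesis by (simp add: norm_mult)
  qed
  moreover have "l \<le> N * (\<bar>\<theta>\<bar> * (sqrt V + 2 * \<rho> * sqrt v) + \<theta>\<^sup>2 / 2 * card J * K ^ 3 + 2 * \<rho>)"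
    if "l \<le> x + y + z" "x \<le> N * (card J * (\<theta>\<^sup>2 / 2 * K ^ 3))"
      "y \<le> \<bar>\<theta>\<bar> * (N * (sqrt V + 2 * \<rho> * sqrt v))" "z \<le> 2 * (N * \<rho>)" for l x y z
    using that by (simp add: algebra_simps)
  ultimately show ?thesis
    unfolding N_def e_def by blast
qed

text \<open>
  If a characteristic function almost satisfies the equation \<open>\<phi>' u = - u \<phi> u\<close> of the standard normal
  distribution, it is close to \<open>exp (- u\<^sup>2 / 2)\<close>: the function \<open>exp (u\<^sup>2 / 2) \<phi> u\<close> starts at 1 and
  has small derivative.
\<close>

lemma characteristic_near_gaussian:
  fixes A :: "'a set" and W :: "'a \<Rightarrow> real" and \<phi> :: "real \<Rightarrow> complex" and \<delta> :: real
  defines "\<phi> \<equiv> \<lambda>u. (\<Sum>a\<in>A. iexp (u * W a)) / card A"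
  assumes A: "finite A" "A \<noteq> {}" and "\<delta> \<ge> 0"
    and ode: "\<And>u. cmod (\<i> * (\<Sum>a\<in>A. W a * iexp (u * W a)) / card A + u * \<phi> u) \<le> \<delta> * (1 + \<bar>u\<bar> + u\<^sup>2)"
  shows "cmod (\<phi> t - complex_of_real (exp (- (t\<^sup>2) / 2))) \<le> \<bar>t\<bar> * (\<delta> * (1 + \<bar>t\<bar> + t\<^sup>2))"
proof -
  define h where "h u = exp (u\<^sup>2 / 2) *\<^sub>R \<phi> u" for u
  define h' where "h' u = exp (u\<^sup>2 / 2) *\<^sub>R (\<i> * (\<Sum>a\<in>A. W a * iexp (u * W a)) / card A + u * \<phi> u)" for u
  define S where "S = {-\<bar>t\<bar>..\<bar>t\<bar>}"
  define B where "B = exp (t\<^sup>2 / 2) * (\<delta> * (1 + \<bar>t\<bar> + t\<^sup>2))"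
  have deriv_\<phi>: "(\<phi> has_vector_derivative (\<i> * (\<Sum>a\<in>A. W a * iexp (u * W a)) / card A)) (at u within S)" for u
  proof -
    have "((\<lambda>u. iexp (u * W a)) has_vector_derivative \<i> * W a * iexp (u * W a)) (at u within S)" for a
    proof -
      have "((\<lambda>z. exp (\<i> * (z * W a))) has_field_derivative \<i> * W a * iexp (u * W a)) (at (of_real u))"
        by (auto intro!: derivative_eq_intros)
      from has_vector_derivative_real_field[OF this] show ?thesis by simp
    qed
    then have "((\<lambda>u. (\<Sum>a\<in>A. iexp (u * W a)) / card A) has_vector_derivative
        (\<Sum>a\<in>A. \<i> * W a * iexp (u * W a)) / card A) (at u within S)"
      by (intro has_vector_derivative_divide has_vector_derivative_sum)
    then show ?thesis
      unfolding \<phi>_def by (simp only: sum_distrib_left mult.assoc)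
  qed
  have "(h has_vector_derivative h' u) (at u within S)" for u
  proof -
    have "((\<lambda>u. exp (u\<^sup>2 / 2)) has_field_derivative u * exp (u\<^sup>2 / 2)) (at u within S)"
      by (auto intro!: derivative_eq_intros)
    from has_vector_derivative_scaleR[OF this deriv_\<phi>] show ?thesis
      unfolding h_def h'_def by (simp add: scaleR_conv_of_real algebra_simps)
  qed
  then have deriv: "(h has_derivative (\<lambda>x. x *\<^sub>R h' u)) (at u within S)" for u
    by (simp add: has_vector_derivative_def)
  have bound: "onorm (\<lambda>x. x *\<^sub>R h' u) \<le> B" if "u \<in> S" for u
  proof (rule onorm_le)
    fix x :: real
    have ut: "\<bar>u\<bar> \<le> \<bar>t\<bar>" using that by (auto simp: S_def)
    then have u2: "u\<^sup>2 \<le> t\<^sup>2" by (simp add: abs_le_square_iff)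
    have "cmod (h' u) \<le> exp (u\<^sup>2 / 2) * (\<delta> * (1 + \<bar>u\<bar> + u\<^sup>2))"
      unfolding h'_def using ode[of u] by simp
    also have "\<dots> \<le> B"
      unfolding B_def using ut u2 assms(4) by (intro mult_mono mult_left_mono add_mono) auto
    finally show "norm (x *\<^sub>R h' u) \<le> B * norm x"
      by (simp add: mult.commute[of B] mult_left_mono)
  qed
  have "cmod (h t - h 0) \<le> B * norm (t - 0)"
    by (rule differentiable_bound[of S h "\<lambda>u x. x *\<^sub>R h' u"]) (use deriv bound in \<open>auto simp: S_def\<close>)
  moreover have "h 0 = 1" using A by (simp add: h_def \<phi>_def)
  moreover have "cmod (\<phi> t - complex_of_real (exp (- (t\<^sup>2) / 2))) = exp (- (t\<^sup>2) / 2) * cmod (h t - 1)"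
  proof -
    have "\<phi> t - complex_of_real (exp (- (t\<^sup>2) / 2)) = exp (- (t\<^sup>2) / 2) *\<^sub>R (h t - 1)"
    proof -
      define E where "E = exp (t\<^sup>2 / 2)"
      have E: "E \<noteq> 0" "exp (- (t\<^sup>2) / 2) = inverse E" by (simp_all add: E_def exp_minus)
      show ?thesis
        unfolding h_def E_def[symmetric] E(2) using E(1) by (simp add: scaleR_conv_of_real field_simps)
    qed
    then show ?thesis by simp
  qed
  ultimately have "cmod (\<phi> t - complex_of_real (exp (- (t\<^sup>2) / 2))) \<le> exp (- (t\<^sup>2) / 2) * (B * \<bar>t\<bar>)"
    by simp
  also have "\<dots> = \<bar>t\<bar> * (\<delta> * (1 + \<bar>t\<bar> + t\<^sup>2))"
    unfolding B_def by (simp add: exp_minus field_simps)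
  finally show ?thesis .
qed

section \<open>Concentration on the symmetric group\<close>

lemma sum_squared_deviation:
  fixes f :: "'a \<Rightarrow> real" and x m :: real
  assumes "finite A" "A \<noteq> {}" and m: "m = (\<Sum>a\<in>A. f a) / card A"
  shows "(\<Sum>a\<in>A. (f a - x)\<^sup>2) = (\<Sum>a\<in>A. (f a - m)\<^sup>2) + card A * (m - x)\<^sup>2"
proof -
  have c: "(\<Sum>a\<in>A. f a) = card A * m"
    using assms by (simp add: card_eq_0_iff)
  have "(\<Sum>a\<in>A. (f a - x)\<^sup>2) = (\<Sum>a\<in>A. (f a - m)\<^sup>2 + (m - x)\<^sup>2 + 2 * (m - x) * f a - 2 * (m - x) * m)"
    by (intro sum.cong refl) (simp add: power2_eq_square algebra_simps)
  also have "\<dots> = (\<Sum>a\<in>A. (f a - m)\<^sup>2) + card A * (m - x)\<^sup>2 + 2 * (m - x) * (\<Sum>a\<in>A. f a)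
      - card A * (2 * (m - x) * m)"
    by (simp add: sum.distrib sum_subtractf sum_distrib_left)
  finally show ?thesis unfolding c by simp
qed

text \<open>
  A function of a uniform permutation that moves by at most \<open>c\<close> under a transposition has variance at
  most \<open>card S * c\<^sup>2\<close>. Induction on \<open>S\<close>: conditioning on the image \<open>b\<close> of a new point \<open>a\<close> leaves
  a function of the same kind on \<open>S\<close>, and the conditional means for \<open>b\<close> and for \<open>a\<close> differ by at
  most \<open>c\<close>, because \<open>transposition a b \<circ> q\<close> is also \<open>q\<close> composed with a transposition on the right.
\<close>

lemma permutations_variance_bound:
  fixes f :: "('a \<Rightarrow> 'a) \<Rightarrow> real" and c :: real
  assumes "finite S"
    and "\<And>p a b. p permutes S \<Longrightarrow> a \<in> S \<Longrightarrow> b \<in> S \<Longrightarrow> \<bar>f (p \<circ> transposition a b) - f p\<bar> \<le> c"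
  shows "(\<Sum>p | p permutes S. (f p - (\<Sum>p | p permutes S. f p) / fact (card S))\<^sup>2)
    \<le> fact (card S) * card S * c\<^sup>2"
  using assms
proof (induction S arbitrary: f rule: finite_induct)
  case empty
  then show ?case by simp
next
  case (insert a S)
  let ?P = "{p. p permutes S}" and ?Q = "{p. p permutes insert a S}"
  define g where "g b q = f (transposition a b \<circ> q)" for b q
  define m where "m b = (\<Sum>q\<in>?P. g b q) / fact (card S)" for b
  have finP: "finite ?P" "?P \<noteq> {}" "card ?P = fact (card S)"
    using insert.hyps card_permutations[OF refl, of S] finite_permutations[of S] permutes_id[of S] by blast+
  have finQ: "finite ?Q" "?Q \<noteq> {}" "card ?Q = fact (card (insert a S))"
    using insert.hyps card_permutations[OF refl, of "insert a S"] finite_permutations[of "insert a S"]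
      permutes_id[of "insert a S"] by blast+
  have perm: "transposition a b \<circ> q permutes insert a S" if "b \<in> insert a S" "q \<in> ?P" for b q
    using that by (auto intro!: permutes_compose permutes_swap_id intro: permutes_subset)
  have bound: "\<bar>f (p \<circ> transposition x y) - f p\<bar> \<le> c"
    if "p permutes insert a S" "x \<in> insert a S" "y \<in> insert a S" for p x y
    using insert.prems that by blast
  have IH: "(\<Sum>q\<in>?P. (g b q - m b)\<^sup>2) \<le> fact (card S) * card S * c\<^sup>2" if b: "b \<in> insert a S" for b
    unfolding m_def
  proof (rule insert.IH)
    fix p x y assume "p permutes S" "x \<in> S" "y \<in> S"
    then show "\<bar>g b (p \<circ> transposition x y) - g b p\<bar> \<le> c"
      using bound[of "transposition a b \<circ> p" x y] perm[OF b, of p] by (simp add: g_def o_assoc)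
  qed
  have close: "\<bar>g b q - g a q\<bar> \<le> c" if "b \<in> insert a S" "q \<in> ?P" for b q
  proof -
    have q: "q permutes insert a S" using that by (auto intro: permutes_subset)
    have "transposition a b \<circ> q = q \<circ> transposition (inv q a) (inv q b)"
      using permutes_bij[OF q] by (rule transpose_comp_eq)
    moreover have "inv q a \<in> insert a S" "inv q b \<in> insert a S"
      using permutes_in_image[OF permutes_inv[OF q]] that by auto
    ultimately show ?thesis
      using bound[OF q, of "inv q a" "inv q b"] by (simp add: g_def)
  qed
  have mclose: "(m b - m a)\<^sup>2 \<le> c\<^sup>2" if "b \<in> insert a S" for b
  proof -
    have "\<bar>\<Sum>q\<in>?P. g b q - g a q\<bar> \<le> (\<Sum>q\<in>?P. c)"
      using close[OF that] by (intro order_trans[OF sum_abs] sum_mono)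
    then have "\<bar>\<Sum>q\<in>?P. g b q - g a q\<bar> \<le> fact (card S) * c"
      using finP by simp
    moreover have "m b - m a = (\<Sum>q\<in>?P. g b q - g a q) / fact (card S)"
      by (simp add: m_def sum_subtractf diff_divide_distrib)
    ultimately have "\<bar>m b - m a\<bar> \<le> c"
      by (simp add: pos_divide_le_eq mult.commute)
    then show ?thesis
      by (rule abs_le_square_iff[THEN iffD1, OF order_trans]) simp
  qed
  \<comment> \<open>deviations may be measured from \<open>m a\<close> instead of the overall mean, which only increases the sum\<close>
  have "(\<Sum>p\<in>?Q. (f p - (\<Sum>p\<in>?Q. f p) / fact (card (insert a S)))\<^sup>2) \<le> (\<Sum>p\<in>?Q. (f p - m a)\<^sup>2)"
    using sum_squared_deviation[OF finQ(1,2) refl, of f "m a"] by (simp add: finQ(3))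
  also have "\<dots> = (\<Sum>b\<in>insert a S. \<Sum>q\<in>?P. (g b q - m a)\<^sup>2)"
    unfolding g_def by (rule sum_over_permutations_insert[OF insert.hyps])
  also have "\<dots> = (\<Sum>b\<in>insert a S. (\<Sum>q\<in>?P. (g b q - m b)\<^sup>2) + fact (card S) * (m b - m a)\<^sup>2)"
    using sum_squared_deviation[OF finP(1,2), of "m b" "g b" "m a" for b] finP(3)
    by (simp add: m_def)
  also have "\<dots> \<le> (\<Sum>b\<in>insert a S. fact (card S) * card S * c\<^sup>2 + fact (card S) * c\<^sup>2)"
    using IH mclose by (intro sum_mono add_mono mult_left_mono) auto
  also have "\<dots> = fact (card (insert a S)) * card (insert a S) * c\<^sup>2"
    using insert.hyps by (simp add: algebra_simps)
  finally show ?case .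
qed

section \<open>The centred descent statistic\<close>

abbreviation step_sign :: "(nat \<Rightarrow> nat) \<Rightarrow> nat \<Rightarrow> real" where
  "step_sign p i \<equiv> sgn (real (p i) - real (p (Suc i)))"

text \<open>The number of descents minus the number of ascents.\<close>

definition descent_balance :: "nat \<Rightarrow> (nat \<Rightarrow> nat) \<Rightarrow> real" where
  "descent_balance n p = (\<Sum>i\<in>{1..<n}. step_sign p i)"

text \<open>
  The centred statistic: on permutations of \<open>{1..n}\<close> it equals \<open>2 (T - (n - 1))\<close>, where \<open>T\<close> is the
  two-sided number of descents.
\<close>

definition two_sided_balance :: "nat \<Rightarrow> (nat \<Rightarrow> nat) \<Rightarrow> real" where
  "two_sided_balance n p = descent_balance n p + descent_balance n (inv p)"

lemma real_descents_eq:
  assumes "p permutes {1..n}" "n \<ge> 1"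
  shows "real (descents n p) = (real n - 1 + descent_balance n p) / 2"
proof -
  have "{i. 1 \<le> i \<and> i \<le> n - 1 \<and> p (i + 1) < p i} = {i \<in> {1..<n}. p (Suc i) < p i}"
    using assms(2) by auto
  then have "real (descents n p) = (\<Sum>i\<in>{1..<n}. of_bool (p (Suc i) < p i))"
    by (simp add: descents_def sum.If_cases Int_def of_bool_def)
  also have "\<dots> = (\<Sum>i\<in>{1..<n}. (1 + sgn (real (p i) - real (p (Suc i)))) / 2)"
  proof (intro sum.cong refl)
    fix i
    have "p i \<noteq> p (Suc i)"
      using permutes_inj[OF assms(1)] by (metis injD n_not_Suc_n)
    then show "of_bool (p (Suc i) < p i) = (1 + sgn (real (p i) - real (p (Suc i)))) / 2"
      by (auto simp: sgn_if)
  qed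
  finally show ?thesis
    using assms(2) by (simp add: descent_balance_def sum_divide_distrib[symmetric] sum.distrib of_nat_diff)
qed

lemma two_sided_descents_eq:
  assumes "p permutes {1..n}" "n \<ge> 1"
  shows "two_sided_descents n p = real n - 1 + two_sided_balance n p / 2"
  using real_descents_eq[OF assms] real_descents_eq[OF permutes_inv[OF assms(1)] assms(2)]
  by (simp add: two_sided_descents_def two_sided_balance_def field_simps)

section \<open>Drift under random transpositions\<close>

text \<open>
  Only transpositions that touch \<open>a\<close> or \<open>b\<close> contribute. For an antisymmetric \<open>F\<close> the contributions of the
  cases \<open>j = a\<close>, \<open>k = a\<close>, \<open>j = b\<close>, \<open>k = b\<close> add up exactly, also where these cases overlap.
\<close>

lemma sum_transpositions_antisymmetric:
  fixes F :: "'a \<Rightarrow> 'a \<Rightarrow> real"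
  assumes "finite N" "a \<in> N" "b \<in> N" "a \<noteq> b" and anti: "\<And>x y. F y x = - F x y"
  shows "(\<Sum>j\<in>N. \<Sum>k\<in>N. F (transposition j k a) (transposition j k b) - F a b)
    = 2 * (\<Sum>k\<in>N. F k b + F a k) - 4 * card N * F a b"
proof -
  have F0: "F x x = 0" for x using anti[of x x] by simp
  define u where "u k = F k b - F a b" for k
  define v where "v k = F a k - F a b" for k
  have "F (transposition j k a) (transposition j k b) - F a b =
      (if j = a then u k else 0) + (if k = a then u j else 0)
      + (if j = b then v k else 0) + (if k = b then v j else 0)" for j k
    using assms(4) anti[of a b] F0 by (auto simp: transpose_def u_def v_def)
  then have "(\<Sum>j\<in>N. \<Sum>k\<in>N. F (transposition j k a) (transposition j k b) - F a b) =
    (\<Sum>j\<in>N. \<Sum>k\<in>N. (if j = a then u k else 0) + (if k = a then u j else 0)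
      + (if j = b then v k else 0) + (if k = b then v j else 0))"
    by simp
  also have "\<dots> = (\<Sum>j\<in>N. (if j = a then \<Sum>k\<in>N. u k else 0) + u j
      + (if j = b then \<Sum>k\<in>N. v k else 0) + v j)"
    using assms(1-3) by (intro sum.cong refl) (simp add: sum.distrib)
  also have "\<dots> = 2 * (\<Sum>k\<in>N. u k) + 2 * (\<Sum>k\<in>N. v k)"
    using assms(1-3) by (simp add: sum.distrib)
  finally show ?thesis
    by (simp add: u_def v_def sum.distrib sum_subtractf algebra_simps)
qed

lemma sum_sgn_permutation:
  assumes "p permutes {1..n}" "x \<in> {1..n}"
  shows "(\<Sum>k\<in>{1..n}. sgn (real x - real (p k))) = 2 * real x - real n - 1"
proof -
  have "(\<Sum>k\<in>{1..n}. sgn (real x - real (p k))) = (\<Sum>k\<in>{1..n}. sgn (real x - real k))"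
    using sum.permute[OF assms(1), of "\<lambda>k. sgn (real x - real k)"] by (simp add: o_def)
  also have "\<dots> = (\<Sum>k\<in>insert x ({1..<x} \<union> {x<..n}). sgn (real x - real k))"
    using assms(2) by (intro sum.cong) auto
  also have "\<dots> = (\<Sum>k\<in>{1..<x} \<union> {x<..n}. sgn (real x - real k))"
    by simp
  also have "\<dots> = (\<Sum>k\<in>{1..<x}. sgn (real x - real k)) + (\<Sum>k\<in>{x<..n}. sgn (real x - real k))"
    by (rule sum.union_disjoint) auto
  also have "(\<Sum>k\<in>{1..<x}. sgn (real x - real k)) = (\<Sum>k\<in>{1..<x}. 1)"
    by (intro sum.cong) auto
  also have "(\<Sum>k\<in>{x<..n}. sgn (real x - real k)) = (\<Sum>k\<in>{x<..n}. -1)"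
    by (intro sum.cong) auto
  finally show ?thesis using assms(2) by (simp add: of_nat_diff)
qed

text \<open>
  Replacing the entry at one end of a step by every possible value turns its sign into the linear
  function \<open>2 p i - n - 1\<close> of the other entry, so the nonlinear part of the drift telescopes to the
  end points.
\<close>

lemma descent_balance_drift:
  assumes "p permutes {1..n}" "n \<ge> 1"
  shows "(\<Sum>j\<in>{1..n}. \<Sum>k\<in>{1..n}. descent_balance n (p \<circ> transposition j k) - descent_balance n p)
    = 4 * (real (p 1) - real (p n)) - 4 * real n * descent_balance n p"
proof -
  define F where "F x y = sgn (real (p x) - real (p y))" for x y
  have anti: "F y x = - F x y" for x y unfolding F_def by (simp add: sgn_if)
  have step: "(\<Sum>j\<in>{1..n}. \<Sum>k\<in>{1..n}. F (transposition j k i) (transposition j k (Suc i)) - F i (Suc i))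
      = 4 * (real (p i) - real (p (Suc i))) - 4 * n * F i (Suc i)" if "i \<in> {1..<n}" for i
  proof -
    have in_range: "p i \<in> {1..n}" "p (Suc i) \<in> {1..n}"
      using that permutes_in_image[OF assms(1), of i] permutes_in_image[OF assms(1), of "Suc i"] by auto
    have "(\<Sum>k\<in>{1..n}. F k (Suc i)) = - (\<Sum>k\<in>{1..n}. F (Suc i) k)"
      unfolding sum_negf[symmetric] by (intro sum.cong refl anti)
    then have "(\<Sum>k\<in>{1..n}. F k (Suc i) + F i k) = 2 * (real (p i) - real (p (Suc i)))"
      using sum_sgn_permutation[OF assms(1) in_range(1)] sum_sgn_permutation[OF assms(1) in_range(2)]
      by (simp add: sum.distrib F_def)
    then show ?thesis
      using sum_transpositions_antisymmetric[of "{1..n}" i "Suc i" F, OF _ _ _ _ anti] that by simp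
  qed
  have "(\<Sum>j\<in>{1..n}. \<Sum>k\<in>{1..n}. descent_balance n (p \<circ> transposition j k) - descent_balance n p)
    = (\<Sum>i\<in>{1..<n}. \<Sum>j\<in>{1..n}. \<Sum>k\<in>{1..n}. F (transposition j k i) (transposition j k (Suc i)) - F i (Suc i))"
    unfolding descent_balance_def F_def sum_subtractf[symmetric]
    by (subst (2) sum.swap, subst sum.swap) simp
  also have "\<dots> = (\<Sum>i\<in>{1..<n}. 4 * (real (p i) - real (p (Suc i))) - 4 * n * F i (Suc i))"
    by (intro sum.cong refl step)
  also have "\<dots> = 4 * (\<Sum>i\<in>{1..<n}. real (p i) - real (p (Suc i))) - 4 * n * descent_balance n p"
    by (simp add: sum_subtractf sum_distrib_left descent_balance_def F_def)
  also have "(\<Sum>i\<in>{1..<n}. real (p i) - real (p (Suc i))) = real (p 1) - real (p n)"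
    using sum_Suc_diff'[of 1 n "\<lambda>i. - real (p i)"] assms(2) by simp
  finally show ?thesis by (simp add: o_def)
qed

lemma inv_comp_transposition:
  assumes "p permutes S"
  shows "inv (p \<circ> transposition j k) = inv p \<circ> transposition (p j) (p k)"
proof -
  have b: "bij p" using assms by (rule permutes_bij)
  have "inv (p \<circ> transposition j k) = transposition j k \<circ> inv p"
    using b by (simp add: o_inv_distrib)
  also have "\<dots> = inv p \<circ> transposition (p j) (p k)"
    using transpose_comp_eq[OF bij_imp_bij_inv[OF b], of j k] by (simp add: inv_inv_eq b)
  finally show ?thesis .
qed

text \<open>
  The same chain acts on \<open>inv p\<close> by the transposition of \<open>p j\<close> and \<open>p k\<close>. As \<open>(j, k)\<close> runs through
  all pairs so does \<open>(p j, p k)\<close>, hence both halves of the statistic have the same drift.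
\<close>

lemma two_sided_balance_drift:
  assumes p: "p permutes {1..n}" and n: "n \<ge> 1"
  shows "(\<Sum>j\<in>{1..n}. \<Sum>k\<in>{1..n}. two_sided_balance n (p \<circ> transposition j k) - two_sided_balance n p)
    = - (4 * real n) * two_sided_balance n p
      + 4 * (real (p 1) - real (p n) + (real (inv p 1) - real (inv p n)))"
proof -
  define h where "h j k = descent_balance n (inv p \<circ> transposition j k) - descent_balance n (inv p)" for j k
  have "(\<Sum>j\<in>{1..n}. \<Sum>k\<in>{1..n}. h (p j) (p k)) = (\<Sum>j\<in>{1..n}. \<Sum>k\<in>{1..n}. h (p j) k)"
    using sum.permute[OF p, of "h (p j)" for j] by (simp add: o_def)
  also have "\<dots> = (\<Sum>j\<in>{1..n}. \<Sum>k\<in>{1..n}. h j k)"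
    using sum.permute[OF p, of "\<lambda>j. \<Sum>k\<in>{1..n}. h j k"] by (simp add: o_def)
  finally have "(\<Sum>j\<in>{1..n}. \<Sum>k\<in>{1..n}. descent_balance n (inv (p \<circ> transposition j k)) - descent_balance n (inv p))
    = 4 * (real (inv p 1) - real (inv p n)) - 4 * real n * descent_balance n (inv p)"
    using descent_balance_drift[OF permutes_inv[OF p] n]
    by (simp only: h_def inv_comp_transposition[OF p])
  then show ?thesis
    using descent_balance_drift[OF p n]
    unfolding two_sided_balance_def by (simp add: sum.distrib sum_subtractf algebra_simps)
qed

section \<open>Locality and concentration of the squared increments\<close>

lemma descent_balance_transposition_le:
  "\<bar>descent_balance n (p \<circ> transposition j k) - descent_balance n p\<bar> \<le> 8"
proof -
  let ?T = "{j, j - 1, k, k - 1}"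
  have "card (set [j, j - 1, k, k - 1]) \<le> 4"
    using card_length[of "[j, j - 1, k, k - 1]"] by simp
  then have card: "card ({1..<n} \<inter> ?T) \<le> 4"
    using card_mono[of ?T "{1..<n} \<inter> ?T"] by simp
  have "\<bar>descent_balance n (p \<circ> transposition j k) - descent_balance n p\<bar>
    \<le> (\<Sum>i\<in>{1..<n}. \<bar>sgn (real (p (transposition j k i)) - real (p (transposition j k (Suc i))))
          - sgn (real (p i) - real (p (Suc i)))\<bar>)"
    unfolding descent_balance_def sum_subtractf[symmetric] by (simp only: o_apply sum_abs)
  also have "\<dots> \<le> (\<Sum>i\<in>{1..<n}. if i \<in> ?T then 2 else 0)"
  proof (intro sum_mono)
    fix i assume "i \<in> {1..<n}"
    show "\<bar>sgn (real (p (transposition j k i)) - real (p (transposition j k (Suc i))))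
          - sgn (real (p i) - real (p (Suc i)))\<bar> \<le> (if i \<in> ?T then 2 else 0)"
    proof (cases "i \<in> ?T")
      case True
      then show ?thesis by (simp only: if_True) (simp add: sgn_if)
    next
      case False
      then have "transposition j k i = i" "transposition j k (Suc i) = Suc i"
        by (auto simp: Transposition.transpose_def)
      then show ?thesis using False by simp
    qed
  qed
  also have "\<dots> = 2 * card ({1..<n} \<inter> ?T)"
    by (simp add: sum.If_cases Int_def)
  finally show ?thesis using card by linarith
qed

lemma two_sided_balance_transposition_le:
  assumes "p permutes S"
  shows "\<bar>two_sided_balance n (p \<circ> transposition j k) - two_sided_balance n p\<bar> \<le> 16"
  using descent_balance_transposition_le[of n p j k]
    descent_balance_transposition_le[of n "inv p" "p j" "p k"]
  unfolding two_sided_balance_def inv_comp_transposition[OF assms] by linarith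

text \<open>
  The points at distance at most one from \<open>l\<close> or \<open>m\<close>. If \<open>l = 0\<close>, the truncated \<open>l - 1\<close> is \<open>l\<close> itself,
  and similarly for \<open>m\<close>.
\<close>

definition neighbourhood :: "nat \<Rightarrow> nat \<Rightarrow> nat set" where
  "neighbourhood l m = {l - 1, l, Suc l, m - 1, m, Suc m}"

lemma finite_neighbourhood: "finite (neighbourhood l m)"
  by (simp add: neighbourhood_def)

lemma card_neighbourhood_le: "card (neighbourhood l m) \<le> 6"
  using card_length[of "[l - 1, l, Suc l, m - 1, m, Suc m]"] by (simp add: neighbourhood_def)

text \<open>
  Transpositions that are not close to each other commute and never affect the same step, so the
  increment caused by one does not notice the other.
\<close>

lemma descent_balance_transposition_local:
  assumes "j \<notin> neighbourhood l m" "k \<notin> neighbourhood l m"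
  shows "descent_balance n (p \<circ> transposition l m \<circ> transposition j k) - descent_balance n (p \<circ> transposition l m)
    = descent_balance n (p \<circ> transposition j k) - descent_balance n p"
  unfolding descent_balance_def sum_subtractf[symmetric]
proof (intro sum.cong refl)
  fix i
  let ?\<kappa> = "transposition l m" and ?\<tau> = "transposition j k"
  have comm: "?\<kappa> (?\<tau> x) = ?\<tau> (?\<kappa> x)" for x
    using assms by (auto simp: neighbourhood_def Transposition.transpose_def)
  have "?\<tau> i = i \<and> ?\<tau> (Suc i) = Suc i \<or> ?\<kappa> i = i \<and> ?\<kappa> (Suc i) = Suc i"
    using assms by (auto simp: neighbourhood_def Transposition.transpose_def)
  then show "sgn (real ((p \<circ> ?\<kappa> \<circ> ?\<tau>) i) - real ((p \<circ> ?\<kappa> \<circ> ?\<tau>) (Suc i)))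
      - sgn (real ((p \<circ> ?\<kappa>) i) - real ((p \<circ> ?\<kappa>) (Suc i)))
    = sgn (real ((p \<circ> ?\<tau>) i) - real ((p \<circ> ?\<tau>) (Suc i))) - sgn (real (p i) - real (p (Suc i)))"
    by (elim disjE) (simp, simp add: comm)
qed

lemma two_sided_balance_transposition_local:
  assumes p: "p permutes S" "l \<in> S" "m \<in> S"
    and "j \<notin> neighbourhood l m" "k \<notin> neighbourhood l m"
    and "p j \<notin> neighbourhood (p l) (p m)" "p k \<notin> neighbourhood (p l) (p m)"
  shows "two_sided_balance n (p \<circ> transposition l m \<circ> transposition j k) - two_sided_balance n (p \<circ> transposition l m)
    = two_sided_balance n (p \<circ> transposition j k) - two_sided_balance n p"
proof -
  have p': "p \<circ> transposition l m permutes S"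
    using p by (intro permutes_compose permutes_swap_id)
  have "transposition l m j = j" "transposition l m k = k"
    using assms(4,5) by (auto simp: neighbourhood_def Transposition.transpose_def)
  then show ?thesis
    using descent_balance_transposition_local[OF assms(4,5), of n p]
      descent_balance_transposition_local[OF assms(6,7), of n "inv p"]
    unfolding two_sided_balance_def inv_comp_transposition[OF p'] inv_comp_transposition[OF p(1)]
    by simp
qed

text \<open>
  The sum over all ordered pairs \<open>(j, k)\<close> of the squared increment of the statistic under the
  transposition of \<open>j\<close> and \<open>k\<close>.
\<close>

definition squared_increments :: "nat \<Rightarrow> (nat \<Rightarrow> nat) \<Rightarrow> real" where
  "squared_increments n p = (\<Sum>j\<in>{1..n}. \<Sum>k\<in>{1..n}.
     (two_sided_balance n (p \<circ> transposition j k) - two_sided_balance n p)\<^sup>2)"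

text \<open>
  There are \<open>n\<^sup>2\<close> summands of size at most \<open>16\<^sup>2\<close>, but by locality only those with \<open>j\<close> or \<open>k\<close> among at
  most 12 points change. Hence the variance of the sum is at most of order \<open>n\<^sup>3\<close>, while its mean is of
  order \<open>n\<^sup>2\<close>.
\<close>

lemma squared_increments_transposition_le:
  assumes p: "p permutes {1..n}" "l \<in> {1..n}" "m \<in> {1..n}"
  shows "\<bar>squared_increments n (p \<circ> transposition l m) - squared_increments n p\<bar> \<le> 6144 * real n"
proof -
  define p' where "p' = p \<circ> transposition l m"
  have p': "p' permutes {1..n}"
    unfolding p'_def using p by (intro permutes_compose permutes_swap_id)
  define D where "D q j k = (two_sided_balance n (q \<circ> transposition j k) - two_sided_balance n q)\<^sup>2" for q j k
  \<comment> \<open>points too close to \<open>l\<close> or \<open>m\<close>, by position or by value, for locality to apply\<close>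
  define bad where "bad = {j \<in> {1..n}. j \<in> neighbourhood l m \<or> p j \<in> neighbourhood (p l) (p m)}"
  have bad_sub: "bad \<subseteq> {1..n}" by (auto simp: bad_def)
  have "bad \<subseteq> neighbourhood l m \<union> inv p ` neighbourhood (p l) (p m)"
    unfolding bad_def using permutes_inverses(2)[OF p(1)] by (auto intro: rev_image_eqI)
  then have "card bad \<le> card (neighbourhood l m \<union> inv p ` neighbourhood (p l) (p m))"
    by (intro card_mono) (simp add: finite_neighbourhood)
  also have "\<dots> \<le> card (neighbourhood l m) + card (inv p ` neighbourhood (p l) (p m))"
    by (rule card_Un_le)
  also have "\<dots> \<le> 6 + 6"
    by (intro add_mono card_neighbourhood_le
        order_trans[OF card_image_le[OF finite_neighbourhood] card_neighbourhood_le])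
  finally have card_bad: "card bad \<le> 12" by simp
  have D_bound: "0 \<le> D q j k \<and> D q j k \<le> 256" if "q permutes {1..n}" for q j k
    using power_mono[OF two_sided_balance_transposition_le[OF that, of n j k] abs_ge_zero, of 2]
    by (simp add: D_def)
  have pointwise: "\<bar>D p' j k - D p j k\<bar> \<le> (if j \<in> bad then 256 else 0) + (if k \<in> bad then 256 else 0)"
    if "j \<in> {1..n}" "k \<in> {1..n}" for j k
  proof (cases "j \<in> bad \<or> k \<in> bad")
    case True
    then show ?thesis
      using D_bound[OF p', of j k] D_bound[OF p(1), of j k] by (auto simp: abs_le_iff)
  next
    case False
    then show ?thesis
      using two_sided_balance_transposition_local[OF p, of j k] that by (simp add: D_def p'_def bad_def)
  qed
  have "\<bar>squared_increments n p' - squared_increments n p\<bar> \<le> (\<Sum>j\<in>{1..n}. \<Sum>k\<in>{1..n}. \<bar>D p' j k - D p j k\<bar>)"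
    unfolding squared_increments_def D_def[symmetric] sum_subtractf[symmetric]
    by (intro order_trans[OF sum_abs] sum_mono order_refl)
  also have "\<dots> \<le> (\<Sum>j\<in>{1..n}. \<Sum>k\<in>{1..n}. (if j \<in> bad then 256 else 0) + (if k \<in> bad then 256 else 0))"
    by (intro sum_mono pointwise)
  also have "\<dots> = 512 * real n * card bad"
    using bad_sub by (simp add: sum.distrib sum.If_cases Int_absorb1 flip: sum_distrib_left)
  also have "\<dots> \<le> 512 * real n * 12"
    using card_bad by (intro mult_left_mono) auto
  finally show ?thesis by (simp add: p'_def)
qed

lemma squared_increments_variance:
  "(\<Sum>p | p permutes {1..n}. (squared_increments n p
      - (\<Sum>p | p permutes {1..n}. squared_increments n p) / fact n)\<^sup>2)
    \<le> fact n * (n * (6144 * real n)\<^sup>2)"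
  using permutations_variance_bound[of "{1..n}" "squared_increments n" "6144 * real n"]
    squared_increments_transposition_le by (simp add: mult.assoc)

section \<open>Mean and variance\<close>

lemma sum_permutations_antisymmetric:
  fixes X :: "(nat \<Rightarrow> nat) \<Rightarrow> real"
  assumes "\<tau> permutes S" "\<And>p. p permutes S \<Longrightarrow> X (p \<circ> \<tau>) = - X p"
  shows "(\<Sum>p | p permutes S. X p) = 0"
proof -
  have "(\<Sum>p | p permutes S. X p) = (\<Sum>p | p permutes S. X (p \<circ> \<tau>))"
    by (rule sum_permutations_compose_right[OF assms(1)])
  also have "\<dots> = - (\<Sum>p | p permutes S. X p)"
    using assms(2) by (simp flip: sum_negf)
  finally show ?thesis by linarith
qed

lemma step_permutes: "i \<in> {1..<n} \<Longrightarrow> transposition i (Suc i) permutes {1..n}"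
  by (rule permutes_swap_id) auto

lemma step_sign_transposition: "step_sign (p \<circ> transposition i (Suc i)) i = - step_sign p i"
  by (simp add: sgn_if)

lemma step_sign_neq: "p permutes S \<Longrightarrow> p i \<noteq> p (Suc i)"
  using permutes_inj[of p S] by (metis injD n_not_Suc_n)

lemma sum_descent_balance: "(\<Sum>p | p permutes {1..n}. descent_balance n p) = 0"
proof -
  have "(\<Sum>p | p permutes {1..n}. step_sign p i) = 0" if "i \<in> {1..<n}" for i
    by (rule sum_permutations_antisymmetric[OF step_permutes[OF that]]) (rule step_sign_transposition)
  then show ?thesis
    unfolding descent_balance_def by (subst sum.swap) simp
qed

lemma sum_two_sided_balance: "(\<Sum>p | p permutes {1..n}. two_sided_balance n p) = 0"
  using sum_permutations_inverse[of "descent_balance n" "{1..n}"] sum_descent_balance[of n]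
  by (simp add: two_sided_balance_def sum.distrib)

text \<open>
  Signs of steps without a common position are uncorrelated: exchanging the entries of one step
  flips its sign and keeps the other.
\<close>

lemma sum_step_sign_distant:
  assumes "i \<in> {1..<n}" "k \<in> {1..<n}" "k \<noteq> i" "k \<noteq> Suc i" "i \<noteq> Suc k"
  shows "(\<Sum>p | p permutes {1..n}. step_sign p i * step_sign p k) = 0"
proof (rule sum_permutations_antisymmetric[OF step_permutes[OF assms(1)]])
  fix p
  have "step_sign (p \<circ> transposition i (Suc i)) k = step_sign p k"
    using assms(3-5) by (simp add: Transposition.transpose_def)
  then show "step_sign (p \<circ> transposition i (Suc i)) i * step_sign (p \<circ> transposition i (Suc i)) k
      = - (step_sign p i * step_sign p k)"
    unfolding step_sign_transposition by simp
qed

text \<open>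
  The signs around a cycle of three distinct values are not all equal, so their pairwise products sum
  to \<open>-1\<close>, and by symmetry the three products have the same mean.
\<close>

lemma sum_step_sign_adjacent:
  assumes "Suc i \<in> {1..<n}" "i \<ge> 1"
  shows "(\<Sum>p | p permutes {1..n}. step_sign p i * step_sign p (Suc i)) = - fact n / 3"
proof -
  let ?P = "{p. p permutes {1..n}}"
  define s where "s p x y = sgn (real (p x) - real (p y))" for p :: "nat \<Rightarrow> nat" and x y :: nat
  define a b c where "a = i" "b = Suc i" "c = Suc (Suc i)"
  have abc: "a \<noteq> b" "b \<noteq> c" "a \<noteq> c" "a \<in> {1..n}" "b \<in> {1..n}" "c \<in> {1..n}"
    using assms by (auto simp: a_b_c_def)
  have anti: "s p x y = - s p y x" for p x y by (simp add: s_def sgn_if)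
  have "(\<Sum>p\<in>?P. s p a b * s p b c)
      = (\<Sum>p\<in>?P. s (p \<circ> transposition a b) a b * s (p \<circ> transposition a b) b c)"
    using abc by (intro sum_permutations_compose_right permutes_swap_id)
  also have "\<dots> = (\<Sum>p\<in>?P. s p a b * s p c a)"
  proof (intro sum.cong refl)
    fix p
    have "s (p \<circ> transposition a b) a b = s p b a" "s (p \<circ> transposition a b) b c = s p a c"
      using abc by (simp_all add: s_def)
    then show "s (p \<circ> transposition a b) a b * s (p \<circ> transposition a b) b c = s p a b * s p c a"
      using anti[of p b a] anti[of p a c] by simp
  qed
  finally have 1: "(\<Sum>p\<in>?P. s p a b * s p c a) = (\<Sum>p\<in>?P. s p a b * s p b c)" ..
  have "(\<Sum>p\<in>?P. s p a b * s p b c)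
      = (\<Sum>p\<in>?P. s (p \<circ> transposition b c) a b * s (p \<circ> transposition b c) b c)"
    using abc by (intro sum_permutations_compose_right permutes_swap_id)
  also have "\<dots> = (\<Sum>p\<in>?P. s p c a * s p b c)"
  proof (intro sum.cong refl)
    fix p
    have "s (p \<circ> transposition b c) a b = s p a c" "s (p \<circ> transposition b c) b c = s p c b"
      using abc by (simp_all add: s_def)
    then show "s (p \<circ> transposition b c) a b * s (p \<circ> transposition b c) b c = s p c a * s p b c"
      using anti[of p c b] anti[of p a c] by simp
  qed
  finally have 2: "(\<Sum>p\<in>?P. s p c a * s p b c) = (\<Sum>p\<in>?P. s p a b * s p b c)" ..
  have "s p a b * s p b c + s p a b * s p c a + s p c a * s p b c = -1" if "p \<in> ?P" for p
  proof -
    have "p a \<noteq> p b" "p b \<noteq> p c" "p a \<noteq> p c"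
      using permutes_inj[of p "{1..n}"] that abc by (auto simp: inj_eq)
    then show ?thesis by (auto simp: s_def sgn_if)
  qed
  then have "(\<Sum>p\<in>?P. s p a b * s p b c + s p a b * s p c a + s p c a * s p b c) = (\<Sum>p\<in>?P. -1)"
    by (intro sum.cong) auto
  then have "3 * (\<Sum>p\<in>?P. s p a b * s p b c) = - real (card ?P)"
    unfolding sum.distrib 1 2 by simp
  then show ?thesis
    using card_permutations[of "{1..n}" n] by (simp add: s_def a_b_c_def)
qed

lemma sum_descent_balance_squared:
  assumes "n \<ge> 2"
  shows "(\<Sum>p | p permutes {1..n}. (descent_balance n p)\<^sup>2) = fact n * (real n + 1) / 3"
proof -
  have cov: "(\<Sum>p | p permutes {1..n}. step_sign p i * step_sign p k) =
     fact n * ((if k = i then 1 else 0) - (if k = Suc i then 1 / 3 else 0) - (if i = Suc k then 1 / 3 else 0))"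
    if "i \<in> {1..<n}" "k \<in> {1..<n}" for i k
  proof -
    consider "k = i" | "k = Suc i" | "i = Suc k" | "k \<noteq> i" "k \<noteq> Suc i" "i \<noteq> Suc k" by blast
    then show ?thesis
    proof cases
      case 1
      have "(\<Sum>p | p permutes {1..n}. step_sign p i * step_sign p i) = (\<Sum>p | p permutes {1..n}. 1)"
        using step_sign_neq[of _ "{1..n}" i] by (intro sum.cong) (auto simp: sgn_if)
      then show ?thesis using 1 card_permutations[of "{1..n}" n] by simp
    next
      case 2
      then show ?thesis using sum_step_sign_adjacent[of i n] that by simp
    next
      case 3
      then show ?thesis using sum_step_sign_adjacent[of k n] that by (simp add: mult.commute)
    next
      case 4
      then show ?thesis using sum_step_sign_distant[OF that] by simp
    qed
  qed
  have "(\<Sum>p | p permutes {1..n}. (descent_balance n p)\<^sup>2)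
    = (\<Sum>i\<in>{1..<n}. \<Sum>k\<in>{1..<n}. \<Sum>p | p permutes {1..n}. step_sign p i * step_sign p k)"
    unfolding descent_balance_def power2_eq_square sum_product
    by (subst sum.swap, subst (2) sum.swap) (rule refl)
  also have "\<dots> = (\<Sum>i\<in>{1..<n}. \<Sum>k\<in>{1..<n}.
     fact n * ((if k = i then 1 else 0) - (if k = Suc i then 1 / 3 else 0) - (if i = Suc k then 1 / 3 else 0)))"
    by (intro sum.cong refl cov)
  also have "\<dots> = fact n * ((\<Sum>i\<in>{1..<n}. \<Sum>k\<in>{1..<n}. if k = i then 1 else 0)
     - (\<Sum>i\<in>{1..<n}. \<Sum>k\<in>{1..<n}. if k = Suc i then 1 / 3 else 0)
     - (\<Sum>k\<in>{1..<n}. \<Sum>i\<in>{1..<n}. if i = Suc k then 1 / 3 else 0))"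
    by (subst (4) sum.swap) (simp add: sum_subtractf flip: sum_distrib_left)
  also have "(\<Sum>i\<in>{1..<n}. \<Sum>k\<in>{1..<n}. if k = i then 1 else 0) = real n - 1"
    using assms by (simp add: of_nat_diff)
  also have "(\<Sum>i\<in>{1..<n}. \<Sum>k\<in>{1..<n}. if k = Suc i then 1 / 3 else (0::real)) = (real n - 2) / 3"
  proof -
    have "{i \<in> {1..<n}. Suc i \<in> {1..<n}} = {1..<n - 1}" by auto
    then show ?thesis using assms by (simp add: sum.If_cases Int_def of_nat_diff)
  qed
  finally show ?thesis by (simp add: field_simps)
qed

lemma exists_permutes_pair:
  assumes "a \<in> N" "b \<in> N" "x \<in> N" "y \<in> N" "a \<noteq> b" "x \<noteq> y"
  obtains \<tau> where "\<tau> permutes N" "\<tau> a = x" "\<tau> b = y"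
proof
  let ?b = "transposition a x b"
  show "transposition ?b y \<circ> transposition a x permutes N"
    using assms by (intro permutes_compose permutes_swap_id) (auto simp: Transposition.transpose_def)
  show "(transposition ?b y \<circ> transposition a x) a = x"
    using assms by (auto simp: Transposition.transpose_def)
  show "(transposition ?b y \<circ> transposition a x) b = y"
    by simp
qed

text \<open>
  The values at two distinct positions are uniformly distributed over pairs of distinct values.
\<close>

lemma sum_permutations_pair:
  fixes f :: "nat \<Rightarrow> nat \<Rightarrow> real"
  assumes "a \<in> {1..n}" "b \<in> {1..n}" "a \<noteq> b"
  shows "real n * (real n - 1) * (\<Sum>p | p permutes {1..n}. f (p a) (p b))
    = fact n * (\<Sum>x\<in>{1..n}. \<Sum>y\<in>{1..n} - {x}. f x y)"
proof -
  let ?N = "{1..n}" and ?P = "{p. p permutes {1..n}}"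
  have same: "(\<Sum>p\<in>?P. f (p x) (p y)) = (\<Sum>p\<in>?P. f (p a) (p b))"
    if xy: "x \<in> ?N" "y \<in> ?N - {x}" for x y
  proof -
    obtain \<tau> where \<tau>: "\<tau> permutes ?N" "\<tau> a = x" "\<tau> b = y"
      using exists_permutes_pair[of a ?N b x y] assms xy by auto
    show ?thesis
      using sum_permutations_compose_right[OF \<tau>(1), of "\<lambda>p. f (p a) (p b)"] \<tau> by simp
  qed
  have reindex: "(\<Sum>x\<in>?N. \<Sum>y\<in>?N - {x}. f (p x) (p y)) = (\<Sum>x\<in>?N. \<Sum>y\<in>?N - {x}. f x y)"
    if p: "p permutes ?N" for p
  proof -
    have "(\<Sum>y\<in>?N - {x}. f (p x) (p y)) = (\<Sum>y\<in>?N - {p x}. f (p x) y)" if "x \<in> ?N" for x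
    proof (rule sum.reindex_bij_betw)
      have "p ` (?N - {x}) = ?N - {p x}"
        using permutes_inj[OF p] permutes_image[OF p] by (simp add: image_set_diff)
      then show "bij_betw p (?N - {x}) (?N - {p x})"
        using permutes_inj_on[OF p] by (auto simp: bij_betw_def)
    qed
    then show ?thesis
      using sum.permute[OF p, of "\<lambda>x. \<Sum>y\<in>?N - {x}. f x y"] by (simp add: o_def)
  qed
  have "real n * (real n - 1) * (\<Sum>p\<in>?P. f (p a) (p b))
      = (\<Sum>x\<in>?N. \<Sum>y\<in>?N - {x}. \<Sum>p\<in>?P. f (p a) (p b))"
    using assms(1) by (simp add: of_nat_diff)
  also have "\<dots> = (\<Sum>x\<in>?N. \<Sum>y\<in>?N - {x}. \<Sum>p\<in>?P. f (p x) (p y))"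
    by (intro sum.cong refl same[symmetric])
  also have "\<dots> = (\<Sum>p\<in>?P. \<Sum>x\<in>?N. \<Sum>y\<in>?N - {x}. f (p x) (p y))"
    by (subst (2) sum.swap, subst sum.swap) (rule refl)
  also have "\<dots> = (\<Sum>p\<in>?P. \<Sum>x\<in>?N. \<Sum>y\<in>?N - {x}. f x y)"
    by (intro sum.cong refl reindex) simp
  finally show ?thesis using card_permutations[of ?N n] by simp
qed

text \<open>
  Exchanging the entries at positions \<open>i\<close> and \<open>Suc i\<close> flips the sign at \<open>i\<close>. It keeps the sign of the
  inverse at \<open>j\<close>, unless these two entries are \<open>j\<close> and \<open>Suc j\<close>; in that case the two signs
  agree. So the correlation is the probability of this event, \<open>2 / (n (n - 1))\<close>.
\<close>

lemma sum_step_sign_inverse: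
  assumes "i \<in> {1..<n}" "j \<in> {1..<n}"
  shows "(\<Sum>p | p permutes {1..n}. step_sign p i * step_sign (inv p) j) = 2 * fact n / (real n * (real n - 1))"
proof -
  let ?P = "{p. p permutes {1..n}}"
  define hit where "hit x y = (if x = i \<and> y = Suc i \<or> x = Suc i \<and> y = i then 1 else (0::real))" for x y
  define X where "X p = step_sign p i * step_sign (inv p) j" for p
  have flip: "X (p \<circ> transposition i (Suc i)) = - X p + 2 * hit (inv p j) (inv p (Suc j))" if "p \<in> ?P" for p
  proof -
    have p: "p permutes {1..n}" using that by simp
    have inv_eq: "inv (p \<circ> transposition i (Suc i)) = transposition i (Suc i) \<circ> inv p"
      using permutes_bij[OF p] by (simp add: o_inv_distrib)
    show ?thesis
    proof (cases "hit (inv p j) (inv p (Suc j)) = 0")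
      case True
      have "inv p j \<noteq> inv p (Suc j)" using step_sign_neq[OF permutes_inv[OF p]] .
      then have "step_sign (transposition i (Suc i) \<circ> inv p) j = step_sign (inv p) j"
        using True by (auto simp: hit_def Transposition.transpose_def sgn_if split: if_splits)
      then show ?thesis
        unfolding X_def step_sign_transposition inv_eq using True by simp
    next
      case False
      then consider "inv p j = i" "inv p (Suc j) = Suc i" | "inv p j = Suc i" "inv p (Suc j) = i"
        by (auto simp: hit_def split: if_splits)
      then show ?thesis
      proof cases
        case 1
        then have "p i = j" "p (Suc i) = Suc j" using permutes_inverses(1)[OF p] by metis+
        then show ?thesis using 1 unfolding X_def inv_eq by (simp add: hit_def)
      next
        case 2
        then have "p i = Suc j" "p (Suc i) = j" using permutes_inverses(1)[OF p] by metis+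
        then show ?thesis using 2 unfolding X_def inv_eq by (simp add: hit_def)
      qed
    qed
  qed
  have "(\<Sum>p\<in>?P. X p) = (\<Sum>p\<in>?P. X (p \<circ> transposition i (Suc i)))"
    by (rule sum_permutations_compose_right[OF step_permutes[OF assms(1)]])
  also have "\<dots> = (\<Sum>p\<in>?P. - X p + 2 * hit (inv p j) (inv p (Suc j)))"
    by (intro sum.cong refl flip)
  also have "\<dots> = - (\<Sum>p\<in>?P. X p) + 2 * (\<Sum>p\<in>?P. hit (p j) (p (Suc j)))"
    using sum_permutations_inverse[of "\<lambda>p. hit (p j) (p (Suc j))" "{1..n}"]
    by (simp add: sum_subtractf flip: sum_distrib_left)
  finally have "(\<Sum>p\<in>?P. X p) = (\<Sum>p\<in>?P. hit (p j) (p (Suc j)))" by simp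
  moreover have "real n * (real n - 1) * (\<Sum>p\<in>?P. hit (p j) (p (Suc j))) = fact n * 2"
  proof -
    have "(\<Sum>y\<in>{1..n} - {x}. hit x y) = (if x = i then 1 else 0) + (if x = Suc i then 1 else 0)"
      if "x \<in> {1..n}" for x
    proof -
      have "hit x y = (if y = Suc i then if x = i then 1 else 0 else 0)
          + (if y = i then if x = Suc i then 1 else 0 else 0)" for y
        by (simp add: hit_def)
      then show ?thesis using assms(1) by (simp add: sum.distrib)
    qed
    then have "(\<Sum>x\<in>{1..n}. \<Sum>y\<in>{1..n} - {x}. hit x y)
      = (\<Sum>x\<in>{1..n}. (if x = i then 1 else 0) + (if x = Suc i then 1 else 0))"
      by (intro sum.cong refl)
    also have "\<dots> = 2" using assms(1) by (simp add: sum.distrib)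
    finally show ?thesis
      using sum_permutations_pair[of j n "Suc j" hit] assms(2) by simp
  qed
  moreover have "real n * (real n - 1) \<noteq> 0" using assms by auto
  ultimately show ?thesis by (simp add: X_def field_simps)
qed

lemma sum_two_sided_balance_squared:
  assumes "n \<ge> 2"
  shows "(\<Sum>p | p permutes {1..n}. (two_sided_balance n p)\<^sup>2)
    = fact n * (4 * ((real n + 7) / 6 - 1 / real n))"
proof -
  let ?P = "{p. p permutes {1..n}}"
  have "(\<Sum>p\<in>?P. descent_balance n p * descent_balance n (inv p))
    = (\<Sum>i\<in>{1..<n}. \<Sum>j\<in>{1..<n}. \<Sum>p\<in>?P. step_sign p i * step_sign (inv p) j)"
    unfolding descent_balance_def sum_product
    by (subst sum.swap, subst (2) sum.swap) (rule refl)
  also have "\<dots> = (\<Sum>i\<in>{1..<n}. \<Sum>j\<in>{1..<n}. 2 * fact n / (real n * (real n - 1)))"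
    by (intro sum.cong refl sum_step_sign_inverse)
  also have "\<dots> = 2 * fact n * (real n - 1) / real n"
    using assms by (simp add: of_nat_diff field_simps)
  finally have cross: "(\<Sum>p\<in>?P. descent_balance n p * descent_balance n (inv p))
      = 2 * fact n * (real n - 1) / real n" .
  have "(\<Sum>p\<in>?P. (two_sided_balance n p)\<^sup>2) = (\<Sum>p\<in>?P. (descent_balance n p)\<^sup>2)
      + (\<Sum>p\<in>?P. (descent_balance n (inv p))\<^sup>2)
      + 2 * (\<Sum>p\<in>?P. descent_balance n p * descent_balance n (inv p))"
    by (simp add: two_sided_balance_def power2_sum sum.distrib sum_distrib_left mult.assoc)
  also have "(\<Sum>p\<in>?P. (descent_balance n (inv p))\<^sup>2) = (\<Sum>p\<in>?P. (descent_balance n p)\<^sup>2)"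
    by (rule sum_permutations_inverse[symmetric])
  finally show ?thesis
    unfolding cross sum_descent_balance_squared[OF assms] using assms by (simp add: field_simps)
qed

section \<open>Convergence of the characteristic functions\<close>

text \<open>For \<open>n \<ge> 2\<close>, the variance of the centred statistic, four times that of the two-sided number of descents.\<close>

definition balance_variance :: "nat \<Rightarrow> real" where
  "balance_variance n = 4 * ((real n + 7) / 6 - 1 / real n)"

lemma permutations_finite_nonempty_card:
  "finite {p. p permutes {1..n}}" "{p. p permutes {1..n}} \<noteq> {}" "card {p. p permutes {1..n}} = fact n"
  using finite_permutations[of "{1..n}"] permutes_id[of "{1..n}"] card_permutations[of "{1..n}" n]
  by (simp, blast, simp)

lemma balance_variance_ge:
  assumes "n \<ge> 2"
  shows "balance_variance n \<ge> real n / 4"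
proof -
  have "1 / real n \<le> 1 / 2" using assms by (intro divide_left_mono) auto
  moreover have "real n \<ge> 2" using assms by simp
  moreover have "4 * ((real n + 7) / 6 - x) \<ge> real n / 4" if "x \<le> 1 / 2" "real n \<ge> 2" for x
    using that by (simp add: field_simps)
  ultimately show ?thesis unfolding balance_variance_def by blast
qed

text \<open>The characteristic function of the centred statistic scaled to unit variance.\<close>

definition balance_characteristic :: "nat \<Rightarrow> real \<Rightarrow> complex" where
  "balance_characteristic n t =
    (\<Sum>p | p permutes {1..n}. iexp (t * (two_sided_balance n p / sqrt (balance_variance n)))) / fact n"

text \<open>
  The bound for the exponential sums with rate \<open>\<kappa> = 4 n\<close>, remainder at most \<open>8 n\<close>, increments at most
  16 and \<open>V = n (6144 n)\<^sup>2\<close>. After division by \<open>2 \<kappa> s\<close> every error term is of order \<open>1 / sqrt n\<close>, since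
  \<open>s\<close> is at least \<open>sqrt n / 2\<close>.
\<close>

lemma balance_characteristic_ode:
  fixes n :: nat and t :: real
  defines "s \<equiv> sqrt (balance_variance n)"
  assumes n: "n \<ge> 2"
  shows "cmod (\<i> * (\<Sum>p | p permutes {1..n}. (two_sided_balance n p / s) * iexp (t * (two_sided_balance n p / s))) / fact n
      + t * balance_characteristic n t) \<le> 3076 / sqrt n * (1 + \<bar>t\<bar> + t\<^sup>2)"
proof -
  define P where "P = {p. p permutes {1..n}}"
  define q where "q = sqrt (real n)"
  define f where "f = two_sided_balance n"
  define \<theta> where "\<theta> = t / s"
  define v where "v = balance_variance n"
  have P: "finite P" "P \<noteq> {}" "card P = fact n"
    unfolding P_def by (rule permutations_finite_nonempty_card)+
  have q: "q > 0" "real n = q\<^sup>2" using n by (auto simp: q_def)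
  have s2: "s\<^sup>2 = v" and s0: "s > 0" and sq: "q / 2 \<le> s"
  proof -
    have "v \<ge> (q / 2)\<^sup>2" using balance_variance_ge[OF n] q by (simp add: v_def power_divide)
    moreover have "(q / 2)\<^sup>2 > 0" using q by simp
    ultimately have "v > 0" "q / 2 \<le> sqrt v" by (linarith, intro real_le_rsqrt)
    then show "s\<^sup>2 = v" "s > 0" "q / 2 \<le> s" by (simp_all add: s_def v_def)
  qed
  have endpoints: "\<bar>real (p 1) - real (p n)\<bar> \<le> n" if "p permutes {1..n}" for p
    using permutes_in_image[OF that, of 1] permutes_in_image[OF that, of n] n by auto
  have increments: "(\<Sum>(j, k)\<in>{1..n} \<times> {1..n}. (f (p \<circ> transposition j k) - f p)\<^sup>2) = squared_increments n p" for p
    by (simp add: squared_increments_def f_def sum.cartesian_product)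
  have "cmod (complex_of_real (2 * (4 * real n)) * (\<Sum>p\<in>P. f p * iexp (\<theta> * f p))
        - complex_of_real (2 * (4 * real n) * v) * (\<i> * \<theta>) * (\<Sum>p\<in>P. iexp (\<theta> * f p)))
    \<le> card P * (\<bar>\<theta>\<bar> * (sqrt (n * (6144 * real n)\<^sup>2) + 2 * (8 * real n) * sqrt v)
        + \<theta>\<^sup>2 / 2 * card ({1..n} \<times> {1..n}) * 16 ^ 3 + 2 * (8 * real n))"
  proof (rule stein_characteristic_bound[OF P(1,2), where \<sigma> = "\<lambda>(j, k) p. p \<circ> transposition j k"
        and r = "\<lambda>p. 4 * (real (p 1) - real (p n) + (real (inv p 1) - real (inv p n)))"])
    fix jk p assume jk: "jk \<in> {1..n} \<times> {1..n}" and "p \<in> P"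
    then have p: "p permutes {1..n}" by (simp add: P_def)
    obtain j k where jk_eq: "jk = (j, k)" "j \<in> {1..n}" "k \<in> {1..n}" using jk by blast
    show "(case jk of (j, k) \<Rightarrow> \<lambda>p. p \<circ> transposition j k) p \<in> P"
      using p jk_eq unfolding P_def by (auto intro!: permutes_compose permutes_swap_id)
    show "(case jk of (j, k) \<Rightarrow> \<lambda>p. p \<circ> transposition j k) ((case jk of (j, k) \<Rightarrow> \<lambda>p. p \<circ> transposition j k) p) = p"
      by (simp add: jk_eq(1) o_assoc[symmetric])
    show "\<bar>f ((case jk of (j, k) \<Rightarrow> \<lambda>p. p \<circ> transposition j k) p) - f p\<bar> \<le> 16"
      using two_sided_balance_transposition_le[OF p] by (simp add: jk_eq(1) f_def)
  next
    fix p assume "p \<in> P"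
    then have p: "p permutes {1..n}" by (simp add: P_def)
    show "(\<Sum>jk\<in>{1..n} \<times> {1..n}. f ((case jk of (j, k) \<Rightarrow> \<lambda>p. p \<circ> transposition j k) p) - f p)
        = - (4 * real n) * f p + 4 * (real (p 1) - real (p n) + (real (inv p 1) - real (inv p n)))"
      using two_sided_balance_drift[OF p] n by (simp add: f_def sum.cartesian_product case_prod_unfold)
    show "\<bar>4 * (real (p 1) - real (p n) + (real (inv p 1) - real (inv p n)))\<bar> \<le> 8 * real n"
    proof -
      have "\<bar>4 * (a + b)\<bar> \<le> 8 * c" if "\<bar>a\<bar> \<le> c" "\<bar>b\<bar> \<le> c" for a b c :: real
        using that by (auto simp: abs_le_iff)
      then show ?thesis
        using endpoints[OF p] endpoints[OF permutes_inv[OF p]] by blast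
    qed
  next
    show "(\<Sum>p\<in>P. (f p)\<^sup>2) = card P * v"
      using sum_two_sided_balance_squared[OF n] P(3) by (simp add: P_def f_def v_def balance_variance_def)
    show "(\<Sum>p\<in>P. ((\<Sum>jk\<in>{1..n} \<times> {1..n}. (f ((case jk of (j, k) \<Rightarrow> \<lambda>p. p \<circ> transposition j k) p) - f p)\<^sup>2)
        - (\<Sum>p\<in>P. \<Sum>jk\<in>{1..n} \<times> {1..n}. (f ((case jk of (j, k) \<Rightarrow> \<lambda>p. p \<circ> transposition j k) p) - f p)\<^sup>2)
          / real (card P))\<^sup>2) \<le> real (card P) * (real n * (6144 * real n)\<^sup>2)"
      using squared_increments_variance[of n] increments P(3) by (simp add: P_def case_prod_unfold)
  qed
  also have "sqrt (n * (6144 * real n)\<^sup>2) = 6144 * q ^ 3"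
    using q by (simp add: real_sqrt_mult power2_eq_square power3_eq_cube)
  also have "sqrt v = s" by (simp add: s_def v_def)
  finally have main: "cmod (8 * q\<^sup>2 * (\<Sum>p\<in>P. f p * iexp (\<theta> * f p)) - 8 * q\<^sup>2 * s\<^sup>2 * (\<i> * \<theta>) * (\<Sum>p\<in>P. iexp (\<theta> * f p)))
    \<le> fact n * (\<bar>\<theta>\<bar> * (6144 * q ^ 3 + 16 * q\<^sup>2 * s) + 2048 * \<theta>\<^sup>2 * q ^ 4 + 16 * q\<^sup>2)"
    using P(3) s2 q(2) by (simp add: card_cartesian_product power2_eq_square power4_eq_xxxx algebra_simps)

  define F where "F = (\<Sum>p\<in>P. f p * iexp (\<theta> * f p))"
  define E where "E = (\<Sum>p\<in>P. iexp (\<theta> * f p))"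
  define X where "X = \<i> * (F / s) / fact n + t * (E / fact n)"
  have "8 * q\<^sup>2 * F - 8 * q\<^sup>2 * s\<^sup>2 * (\<i> * \<theta>) * E = of_real (fact n * (8 * q\<^sup>2 * s)) * (- \<i>) * X"
    using s0 by (simp add: X_def \<theta>_def field_simps power2_eq_square)
  then have "cmod (8 * q\<^sup>2 * F - 8 * q\<^sup>2 * s\<^sup>2 * (\<i> * \<theta>) * E) = fact n * (8 * q\<^sup>2 * s * cmod X)"
    using s0 by (simp only: norm_mult norm_of_real norm_minus_cancel norm_ii) (simp add: abs_mult)
  with main have X_le: "8 * q\<^sup>2 * s * cmod X \<le> \<bar>\<theta>\<bar> * (6144 * q ^ 3 + 16 * q\<^sup>2 * s) + 2048 * \<theta>\<^sup>2 * q ^ 4 + 16 * q\<^sup>2"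
    unfolding F_def[symmetric] E_def[symmetric] by simp
  define y where "y = 1 / s"
  have y: "0 < y" "y \<le> 2 / q" using s0 q sq by (auto simp: y_def field_simps)
  have "cmod X \<le> (\<bar>\<theta>\<bar> * (6144 * q ^ 3 + 16 * q\<^sup>2 * s) + 2048 * \<theta>\<^sup>2 * q ^ 4 + 16 * q\<^sup>2) / (8 * q\<^sup>2 * s)"
    using X_le q(1) s0 by (simp add: pos_le_divide_eq mult.commute)
  also have "\<dots> = \<bar>t\<bar> * (768 * q * y\<^sup>2 + 2 * y) + t\<^sup>2 * (256 * q\<^sup>2 * y ^ 3) + 2 * y"
    using s0 q(1) by (simp add: y_def \<theta>_def abs_divide field_simps power2_eq_square power3_eq_cube power4_eq_xxxx)
  also have "\<dots> \<le> \<bar>t\<bar> * (3076 / q) + t\<^sup>2 * (3076 / q) + 3076 / q"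
  proof (intro add_mono mult_left_mono)
    have "y\<^sup>2 \<le> (2 / q)\<^sup>2" "y ^ 3 \<le> (2 / q) ^ 3" using y by (intro power_mono; simp)+
    then have "q * y\<^sup>2 \<le> q * (2 / q)\<^sup>2" "q\<^sup>2 * y ^ 3 \<le> q\<^sup>2 * (2 / q) ^ 3"
      using q by (intro mult_left_mono; simp)+
    moreover define z where "z = 1 / q"
    moreover have "q * (2 / q)\<^sup>2 = 4 * z" "q\<^sup>2 * (2 / q) ^ 3 = 8 * z" "2 / q = 2 * z" "3076 / q = 3076 * z" "z > 0"
      using q by (simp_all add: z_def power2_eq_square power3_eq_cube)
    ultimately show "768 * q * y\<^sup>2 + 2 * y \<le> 3076 / q" "256 * q\<^sup>2 * y ^ 3 \<le> 3076 / q" "2 * y \<le> 3076 / q"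
      using y(2) unfolding mult.assoc by linarith+
  qed auto
  also have "\<dots> = 3076 / sqrt n * (1 + \<bar>t\<bar> + t\<^sup>2)"
  proof -
    have "\<bar>t\<bar> * c + t\<^sup>2 * c + c = c * (1 + \<bar>t\<bar> + t\<^sup>2)" for c :: real
      by (simp add: algebra_simps)
    then show ?thesis unfolding q_def .
  qed
  also have "X = \<i> * (\<Sum>p\<in>P. (f p / s) * iexp (t * (f p / s))) / fact n + t * balance_characteristic n t"
    by (simp add: X_def F_def E_def \<theta>_def balance_characteristic_def P_def f_def s_def sum_divide_distrib)
  finally show ?thesis by (simp add: P_def f_def)
qed

lemma balance_characteristic_tendsto:
  "(\<lambda>n. balance_characteristic n t) \<longlonglongrightarrow> complex_of_real (exp (- (t\<^sup>2) / 2))"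
proof (rule Lim_null[THEN iffD2], rule Lim_null_comparison)
  show "\<forall>\<^sub>F n in sequentially. norm (balance_characteristic n t - complex_of_real (exp (- (t\<^sup>2) / 2)))
      \<le> \<bar>t\<bar> * (3076 / sqrt n * (1 + \<bar>t\<bar> + t\<^sup>2))"
  proof (rule eventually_sequentiallyI)
    fix n :: nat assume n: "2 \<le> n"
    define P where "P = {p. p permutes {1..n}}"
    have P: "finite P" "P \<noteq> {}" "card P = fact n"
      unfolding P_def by (rule permutations_finite_nonempty_card)+
    define W where "W p = two_sided_balance n p / sqrt (balance_variance n)" for p
    have char_eq: "balance_characteristic n u = (\<Sum>p\<in>P. iexp (u * W p)) / card P" for u
      unfolding balance_characteristic_def P_def[symmetric] W_def P(3) by simp
    show "norm (balance_characteristic n t - complex_of_real (exp (- (t\<^sup>2) / 2)))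
        \<le> \<bar>t\<bar> * (3076 / sqrt n * (1 + \<bar>t\<bar> + t\<^sup>2))"
      unfolding char_eq
    proof (rule characteristic_near_gaussian[OF P(1,2)])
      fix u
      show "cmod (\<i> * (\<Sum>p\<in>P. W p * iexp (u * W p)) / card P + u * ((\<Sum>p\<in>P. iexp (u * W p)) / card P))
          \<le> 3076 / sqrt n * (1 + \<bar>u\<bar> + u\<^sup>2)"
        unfolding char_eq[symmetric] using balance_characteristic_ode[OF n, of u]
        unfolding P_def[symmetric] W_def P(3) by simp
    qed simp
  qed
  have "(\<lambda>n. 3076 / sqrt (real n)) \<longlonglongrightarrow> 0"
    by real_asymp
  then have "(\<lambda>n. \<bar>t\<bar> * (3076 / sqrt (real n) * (1 + \<bar>t\<bar> + t\<^sup>2))) \<longlonglongrightarrow> \<bar>t\<bar> * (0 * (1 + \<bar>t\<bar> + t\<^sup>2))"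
    by (intro tendsto_mult tendsto_const)
  then show "(\<lambda>n. \<bar>t\<bar> * (3076 / sqrt (real n) * (1 + \<bar>t\<bar> + t\<^sup>2))) \<longlonglongrightarrow> 0"
    by simp
qed

lemma expectation_uniform_perm:
  fixes X :: "(nat \<Rightarrow> nat) \<Rightarrow> 'b :: {banach, second_countable_topology}"
  shows "measure_pmf.expectation (uniform_perm n) X = (\<Sum>p | p permutes {1..n}. X p) /\<^sub>R fact n"
proof -
  note P = permutations_finite_nonempty_card[of n]
  show ?thesis
    unfolding uniform_perm_def sym_group_def using P
    by (subst integral_measure_pmf[OF P(1)]) (auto simp: scaleR_right.sum inverse_eq_divide)
qed

lemma expectation_two_sided_descents:
  assumes "n \<ge> 2"
  shows "measure_pmf.expectation (uniform_perm n) (two_sided_descents n) = real n - 1"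
proof -
  have "(\<Sum>p | p permutes {1..n}. two_sided_descents n p)
      = (\<Sum>p | p permutes {1..n}. real n - 1 + two_sided_balance n p / 2)"
    using two_sided_descents_eq assms by (intro sum.cong) auto
  also have "\<dots> = fact n * (real n - 1)"
    using sum_two_sided_balance[of n] card_permutations[of "{1..n}" n]
    by (simp add: sum.distrib flip: sum_divide_distrib)
  finally show ?thesis by (simp add: expectation_uniform_perm)
qed

lemma variance_two_sided_descents:
  assumes "n \<ge> 2"
  shows "measure_pmf.variance (uniform_perm n) (two_sided_descents n) = balance_variance n / 4"
proof -
  have "(\<Sum>p | p permutes {1..n}. (two_sided_descents n p - (real n - 1))\<^sup>2)
      = (\<Sum>p | p permutes {1..n}. (two_sided_balance n p)\<^sup>2 / 4)"
    using two_sided_descents_eq assms by (intro sum.cong) (auto simp: power_divide)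
  also have "\<dots> = fact n * (balance_variance n / 4)"
    using sum_two_sided_balance_squared[OF assms]
    by (simp add: balance_variance_def flip: sum_divide_distrib)
  finally have "(\<Sum>p | p permutes {1..n}. (two_sided_descents n p - (real n - 1))\<^sup>2)
      = fact n * (balance_variance n / 4)" .
  then show ?thesis
    unfolding expectation_two_sided_descents[OF assms]
    unfolding expectation_uniform_perm by (simp only:) simp
qed

lemma char_normalized_two_sided_descents:
  fixes n :: nat
  defines "M \<equiv> measure_pmf (uniform_perm n)"
  assumes "n \<ge> 2"
  shows "char (distr M borel (\<lambda>p. (two_sided_descents n p - measure_pmf.expectation (uniform_perm n) (two_sided_descents n))
      / sqrt (measure_pmf.variance (uniform_perm n) (two_sided_descents n)))) t = balance_characteristic n t"
proof -
  have "(\<Sum>p | p permutes {1..n}. iexp (t * ((two_sided_descents n p - (real n - 1)) / sqrt (balance_variance n / 4))))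
    = (\<Sum>p | p permutes {1..n}. iexp (t * (two_sided_balance n p / sqrt (balance_variance n))))"
    using two_sided_descents_eq assms(2)
    by (intro sum.cong) (auto simp: real_sqrt_divide)
  then show ?thesis
    unfolding variance_two_sided_descents[OF assms(2)] M_def
    unfolding expectation_two_sided_descents[OF assms(2)]
    by (simp add: char_def integral_distr expectation_uniform_perm balance_characteristic_def
        scaleR_conv_of_real field_simps)
qed

theorem theorem1p1:
  shows "(\<forall>n\<ge>2.
      measure_pmf.expectation (uniform_perm n) (two_sided_descents n) = real n - 1 \<and>
      measure_pmf.variance (uniform_perm n) (two_sided_descents n) = (real n + 7) / 6 - 1 / real n)
    \<and> weak_conv_m
      (\<lambda>n. distr (measure_pmf (uniform_perm n)) borel
        (\<lambda>p. (two_sided_descents n p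
                - measure_pmf.expectation (uniform_perm n) (two_sided_descents n))
              / sqrt (measure_pmf.variance (uniform_perm n) (two_sided_descents n))))
      std_normal_distribution"
proof (intro conjI allI impI)
  fix n :: nat assume n: "2 \<le> n"
  show "measure_pmf.expectation (uniform_perm n) (two_sided_descents n) = real n - 1"
    by (rule expectation_two_sided_descents[OF n])
  show "measure_pmf.variance (uniform_perm n) (two_sided_descents n) = (real n + 7) / 6 - 1 / real n"
    unfolding variance_two_sided_descents[OF n] by (simp add: balance_variance_def)
next
  show "weak_conv_m
      (\<lambda>n. distr (measure_pmf (uniform_perm n)) borel
        (\<lambda>p. (two_sided_descents n p
                - measure_pmf.expectation (uniform_perm n) (two_sided_descents n))
              / sqrt (measure_pmf.variance (uniform_perm n) (two_sided_descents n))))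
      std_normal_distribution" (is "weak_conv_m ?M _")
  proof (rule levy_continuity)
    show "real_distribution (?M n)" for n
      by (rule prob_space.real_distribution_distr) (simp_all add: measure_pmf.prob_space_axioms)
    show "real_distribution std_normal_distribution"
      by (rule real_dist_normal_dist)
    fix t
    have "\<forall>\<^sub>F n in sequentially. balance_characteristic n t = char (?M n) t"
      using char_normalized_two_sided_descents by (intro eventually_sequentiallyI[of 2]) simp
    then show "(\<lambda>n. char (?M n) t) \<longlonglongrightarrow> char std_normal_distribution t"
      unfolding char_std_normal_distribution
      by (rule Lim_transform_eventually[OF balance_characteristic_tendsto])
  qed
qed

end
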